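(* Every ab-ba rotor type $r$ whose period consists of more than one block $12$ and exactly one block $21$ is universal.
   Context: A rotor type is an infinite periodic sequence $r=(r^{(1)},r^{(2)},\dots)$ of natural numbers (states), with fundamental period $|r|$; two rotor types are equivalent if one is obtained from the other by an injective relabeling of states. A two-state rotor type is written over $\{1,2\}$ with $r^{(1)}=1$; it is ab-ba if $|r|$ is even and for every $k\ge 0$ the pair $(r^{(2k+1)},r^{(2k+2)})$ (called the $(k+1)$-th block) is $12$ or $21$. A rotor-router network consists of a finite digraph (loops and multiple edges allowed), a source vertex, a set of target vertices of outdegree $0$ such that every non-target vertex can reach a target, and at each non-target vertex $v$ a periodic sequence $e_v^{(1)},e_v^{(2)},\dots$ of out-edges; a particle starts at the source, on its $n$-th visit to a non-target vertex $v$ leaves along $e_v^{(n)}$, and whenever it reaches a target it is returned to the source. The hitting sequence is the (periodic) sequence of targets reached. A network is homogeneous of type $r$ if at every non-target vertex $v$, $e_v^{(n)}=\phi_v(r^{(n)})$ for some injective map $\phi_v$ from states of $r$ to out-edges of $v$. A rotor type $r$ models $r'$ if some homogeneous network of type $r$ has hitting sequence (targets regarded as states) equivalent to $r'$; $r$ is universal if it models every rotor type. *)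

theory Defs
  imports "Graph_Theory.Digraph"
begin

text \<open>
  Sequences are functions on \<^typ>\<open>nat\<close>, indexed from 0: the term written
  \<open>r\<close> with superscript \<open>(n)\<close>, for \<open>n \<ge> 1\<close>, is \<open>r (n - 1)\<close> here. The states
  of \<open>r\<close> are the elements of \<open>range r\<close>.
\<close>

definition periodic :: "(nat \<Rightarrow> 'a) \<Rightarrow> bool" where
  "periodic r \<longleftrightarrow> (\<exists>p>0. \<forall>n. r (n + p) = r n)"

definition fundamental_period :: "(nat \<Rightarrow> 'a) \<Rightarrow> nat" where
  "fundamental_period r = (LEAST p. p > 0 \<and> (\<forall>n. r (n + p) = r n))"

definition rotor_type :: "(nat \<Rightarrow> nat) \<Rightarrow> bool" where
  "rotor_type r \<longleftrightarrow> periodic r"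

definition rotor_equiv :: "(nat \<Rightarrow> nat) \<Rightarrow> (nat \<Rightarrow> nat) \<Rightarrow> bool" where
  "rotor_equiv r r' \<longleftrightarrow> (\<exists>f. inj_on f (range r) \<and> (\<forall>n. r' n = f (r n)))"

definition two_state :: "(nat \<Rightarrow> nat) \<Rightarrow> bool" where
  "two_state r \<longleftrightarrow> rotor_type r \<and> range r = {1, 2} \<and> r 0 = 1"

text \<open>\<open>block r k\<close> is the \<open>(k + 1)\<close>-th block of \<open>r\<close>.\<close>

definition block :: "(nat \<Rightarrow> nat) \<Rightarrow> nat \<Rightarrow> nat \<times> nat" where
  "block r k = (r (2 * k), r (2 * k + 1))"

definition ab_ba :: "(nat \<Rightarrow> nat) \<Rightarrow> bool" where
  "ab_ba r \<longleftrightarrow> two_state r \<and> even (fundamental_period r) \<and>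
     (\<forall>k. block r k = (1, 2) \<or> block r k = (2, 1))"

text \<open>The number of occurrences of the block \<open>b\<close> in one fundamental period.\<close>

definition block_count :: "(nat \<Rightarrow> nat) \<Rightarrow> nat \<times> nat \<Rightarrow> nat" where
  "block_count r b = card {k. k < fundamental_period r div 2 \<and> block r k = b}"

locale rotor_network = fin_digraph G
  for G :: "('v, 'e) pre_digraph" (structure) +
  fixes src :: 'v
    and targets :: "'v set"
    and rotor :: "'v \<Rightarrow> nat \<Rightarrow> 'e"
  assumes src_in_verts: "src \<in> verts G"
    and targets_subset: "targets \<subseteq> verts G"
    and out_degree_target: "\<And>t. t \<in> targets \<Longrightarrow> out_degree G t = 0"
    and reaches_target: "\<And>v. v \<in> verts G - targets \<Longrightarrow> \<exists>t\<in>targets. v \<rightarrow>\<^sup>*\<^bsub>G\<^esub> t"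
    and rotor_out_arc: "\<And>v n. v \<in> verts G - targets \<Longrightarrow> rotor v n \<in> out_arcs G v"
    and rotor_periodic: "\<And>v. v \<in> verts G - targets \<Longrightarrow> periodic (rotor v)"

text \<open>
  The second component of \<open>rotor_walk\<close> records how often the particle has
  already left each vertex. The return from a target to the source takes one
  time step, and the arrival at the source counts as a visit.
\<close>

primrec rotor_walk ::
  "('v, 'e) pre_digraph \<Rightarrow> 'v \<Rightarrow> 'v set \<Rightarrow> ('v \<Rightarrow> nat \<Rightarrow> 'e) \<Rightarrow> nat \<Rightarrow> 'v \<times> ('v \<Rightarrow> nat)"
where
  "rotor_walk G src targets rotor 0 = (src, \<lambda>_. 0)"
| "rotor_walk G src targets rotor (Suc t) =
     (let (v, c) = rotor_walk G src targets rotor t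
      in if v \<in> targets then (src, c)
         else (head G (rotor v (c v)), c(v := Suc (c v))))"

definition particle_position ::
  "('v, 'e) pre_digraph \<Rightarrow> 'v \<Rightarrow> 'v set \<Rightarrow> ('v \<Rightarrow> nat \<Rightarrow> 'e) \<Rightarrow> nat \<Rightarrow> 'v"
where
  "particle_position G src targets rotor t = fst (rotor_walk G src targets rotor t)"

text \<open>
  The function \<open>\<tau>\<close> enumerates the times at which the particle is at a target; in
  particular there are infinitely many of them. This is not automatic, because
  a target may be reachable only through arcs that no rotor uses.
\<close>

definition hitting_sequence ::
  "('v, 'e) pre_digraph \<Rightarrow> 'v \<Rightarrow> 'v set \<Rightarrow> ('v \<Rightarrow> nat \<Rightarrow> 'e) \<Rightarrow> (nat \<Rightarrow> 'v) \<Rightarrow> bool"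
where
  "hitting_sequence G src targets rotor h \<longleftrightarrow>
     (\<exists>\<tau>. strict_mono \<tau> \<and>
          range \<tau> = {t. particle_position G src targets rotor t \<in> targets} \<and>
          (\<forall>n. h n = particle_position G src targets rotor (\<tau> n)))"

definition homogeneous ::
  "('v, 'e) pre_digraph \<Rightarrow> 'v set \<Rightarrow> ('v \<Rightarrow> nat \<Rightarrow> 'e) \<Rightarrow> (nat \<Rightarrow> nat) \<Rightarrow> bool"
where
  "homogeneous G targets rotor r \<longleftrightarrow>
     (\<forall>v \<in> verts G - targets. \<exists>\<phi>. inj_on \<phi> (range r) \<and> \<phi> ` range r \<subseteq> out_arcs G v \<and>
        (\<forall>n. rotor v n = \<phi> (r n)))"

text \<open>
  Finite digraphs may be taken with natural numbers as vertices and arcs, so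
  that the targets hit are themselves states.
\<close>

definition models :: "(nat \<Rightarrow> nat) \<Rightarrow> (nat \<Rightarrow> nat) \<Rightarrow> bool" where
  "models r r' \<longleftrightarrow>
     (\<exists>(G :: (nat, nat) pre_digraph) src targets rotor h.
        rotor_network G src targets rotor \<and> homogeneous G targets rotor r \<and>
        hitting_sequence G src targets rotor h \<and> rotor_equiv h r')"

definition universal :: "(nat \<Rightarrow> nat) \<Rightarrow> bool" where
  "universal r \<longleftrightarrow> rotor_type r \<and> (\<forall>r'. rotor_type r' \<longrightarrow> models r r')"

end

theory Submission
  imports Defs
begin

text \<open>
  A tree of rotors whose leaves are targets or arcs back to the root produces a sequence from
  those of its subtrees, by interleaving along the rotor type of the root and by deleting a
  symbol. It suffices to simulate a rotor that alternates between its two states: a complete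
  binary tree of those is a round robin of length \<open>2 ^ j\<close>, and deleting symbols gives round
  robins of every length, whose leaves may be labelled arbitrarily.

  To obtain alternation, give the root blocks flipped according to \<open>\<sigma>\<close> and its two children
  blocks flipped according to \<open>\<tau>\<close>, and let each child send one of its two states back to the
  root. This simulates blocks flipped according to \<open>\<sigma>\<close> along the visits at which the children
  emit, which are one visit out of each pair. If exactly the blocks with index \<open>a\<close>
  modulo \<open>m > 2\<close> are flipped at the start, where \<open>0 < a < m\<close>, then at most two such steps skip
  every flipped block.
\<close>

section \<open>Sequences produced by trees of rotors with feedback\<close>

definition count :: "(nat \<Rightarrow> bool) \<Rightarrow> nat \<Rightarrow> nat" where
  "count w n = card {k. k < n \<and> w k}"

lemma count_0 [simp]: "count w 0 = 0"
  by (simp add: count_def)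

lemma count_Suc: "count w (Suc n) = (if w n then Suc (count w n) else count w n)"
proof -
  have "{k. k < Suc n \<and> w k} = (if w n then insert n {k. k < n \<and> w k} else {k. k < n \<and> w k})"
    by (auto simp: less_Suc_eq)
  then show ?thesis
    by (simp add: count_def)
qed

text \<open>A root with rotor \<open>w\<close> sends its visit to \<open>s\<close> in state
  \<open>False\<close> and to \<open>t\<close> in state \<open>True\<close>; the symbol read there
  is indexed by the number of earlier visits to that subtree.\<close>

definition interleave :: "(nat \<Rightarrow> bool) \<Rightarrow> (nat \<Rightarrow> 'a) \<Rightarrow> (nat \<Rightarrow> 'a) \<Rightarrow> nat \<Rightarrow> 'a" where
  "interleave w s t n = (if w n then t (count w n) else s (count (\<lambda>k. \<not> w k) n))"

text \<open>\<open>const\<close> is a lone target, \<open>split\<close> a root over two disjoint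
  subtrees, and \<open>feedback\<close> redirects the arcs into target \<open>z\<close> to the root.
  An enumeration \<open>e\<close> exists only if infinitely many symbols survive, so feedback never
  traps the particle.\<close>

inductive produces :: "(nat \<Rightarrow> bool) \<Rightarrow> (nat \<Rightarrow> nat) \<Rightarrow> bool" for w where
  const: "produces w (\<lambda>_. x)"
| split: "produces w s \<Longrightarrow> produces w t \<Longrightarrow> produces w (interleave w s t)"
| feedback: "produces w s \<Longrightarrow> strict_mono e \<Longrightarrow> range e = {n. s n \<noteq> z} \<Longrightarrow> produces w (s \<circ> e)"

text \<open>This leaves a fresh label with which symbols to be deleted can be marked.\<close>

lemma produces_finite_range: "produces w s \<Longrightarrow> finite (range s)"
proof (induction rule: produces.induct)
  case (split s t)
  have "range (interleave w s t) \<subseteq> range s \<union> range t"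
    by (auto simp: interleave_def)
  then show ?case
    using split by (meson finite_UnI finite_subset)
next
  case (feedback s e z)
  then show ?case
    by (metis finite_subset image_comp image_mono subset_UNIV)
qed simp

text \<open>Any root may then be treated as if its rotor were \<open>u\<close>; quantifying over
  both subtrees lets simulated rotors be nested.\<close>

definition simulates :: "(nat \<Rightarrow> bool) \<Rightarrow> (nat \<Rightarrow> bool) \<Rightarrow> bool" where
  "simulates w u \<longleftrightarrow>
     (\<forall>s t. produces w s \<longrightarrow> produces w t \<longrightarrow> produces w (interleave u s t))"

lemma simulates_self: "simulates w w"
  by (simp add: simulates_def produces.split)

text \<open>Exchanging the two subtrees of a root complements its rotor.\<close>

lemma simulates_Not:
  assumes "simulates w u"
  shows "simulates w (\<lambda>n. \<not> u n)"
proof -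
  have "interleave (\<lambda>n. \<not> u n) s t = interleave u t s" for s t :: "nat \<Rightarrow> nat"
    by (auto simp: interleave_def)
  with assms show ?thesis
    by (simp add: simulates_def)
qed

section \<open>Sequences of blocks\<close>

text \<open>With \<open>True\<close> for state 2, block \<open>i\<close> is 21 if
  \<open>\<sigma> i\<close> holds and 12 otherwise.\<close>

definition ab :: "(nat \<Rightarrow> bool) \<Rightarrow> nat \<Rightarrow> bool" where
  "ab \<sigma> n \<longleftrightarrow> odd n \<noteq> \<sigma> (n div 2)"

lemma ab_Not: "ab (\<lambda>i. \<not> \<sigma> i) = (\<lambda>n. \<not> ab \<sigma> n)"
  by (auto simp: ab_def)

lemma count_ab: "count (ab \<sigma>) (2 * n) = n"
  by (induction n) (auto simp: count_Suc ab_def)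

lemma count_ab_div: "ab \<sigma> n \<Longrightarrow> count (ab \<sigma>) n = n div 2"
  using count_ab[of \<sigma> "n div 2"]
  by (cases "even n") (auto simp: ab_def count_Suc elim!: evenE oddE)

text \<open>Each block visits each subtree once, so flips change the order of the visits but not the
  index that is read.\<close>

lemma interleave_ab:
  "interleave (ab \<sigma>) s t n = (if ab \<sigma> n then t (n div 2) else s (n div 2))"
  using count_ab_div[of \<sigma> n] count_ab_div[of "\<lambda>i. \<not> \<sigma> i" n]
  by (auto simp: interleave_def ab_Not)

text \<open>
  Both children of a root of type \<open>ab \<sigma>\<close> are visited once per block of the root, so
  children of the same type emit in the same blocks; a child of type \<open>ab \<tau>\<close> emits its
  \<open>i\<close>-th symbol at its visit number \<open>2 * i\<close> or \<open>2 * i + 1\<close>.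
\<close>

lemma simulates_thin:
  assumes \<sigma>: "simulates w (ab \<sigma>)" and \<tau>: "simulates w (ab \<tau>)"
  shows "simulates w (ab (\<lambda>i. \<sigma> (2 * i + (if \<tau> i then 0 else 1))))"
  unfolding simulates_def
proof (intro allI impI)
  fix s t assume st: "produces w s" "produces w t"
  define e where "e i = 2 * i + (if \<tau> i then 0 else 1)" for i :: nat
  have "finite (range s \<union> range t)"
    using st by (simp add: produces_finite_range)
  then obtain z where z: "z \<notin> range s \<union> range t"
    using ex_new_if_finite infinite_UNIV_nat by blast
  \<comment> \<open>Before feedback: a child emits the dummy \<open>z\<close> in state
    \<open>False\<close> and a proper symbol in state \<open>True\<close>.\<close>
  define X where
    "X = interleave (ab \<sigma>) (interleave (ab \<tau>) (\<lambda>_. z) s) (interleave (ab \<tau>) (\<lambda>_. z) t)"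
  have X: "produces w X"
    using \<sigma> \<tau> st produces.const unfolding X_def simulates_def by blast
  \<comment> \<open>A child emits its symbol number \<open>i\<close> at its visit
    \<open>e i\<close>, hence in block \<open>e i\<close> of the root. So block
    \<open>e (n div 2)\<close> survives as block \<open>n div 2\<close>, with the order inside it
    unchanged.\<close>
  define E where "E n = 2 * e (n div 2) + n mod 2" for n
  have E_div: "E n div 2 = e (n div 2)" and E_odd: "odd (E n) = odd n" for n
    by (auto simp: E_def)
  have e_div: "e i div 2 = i" and e_ab: "ab \<tau> (e i)" for i
    by (auto simp: e_def ab_def)
  have mono_E: "strict_mono E"
    unfolding strict_mono_Suc_iff
  proof
    fix n show "E n < E (Suc n)"
      by (cases "even n") (auto simp: E_def e_def elim!: evenE oddE)
  qed
  have X_eq: "X n = (if ab \<tau> (n div 2)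
      then if ab \<sigma> n then t (n div 2 div 2) else s (n div 2 div 2) else z)" for n
    by (simp add: X_def interleave_ab)
  have "range E = {n. X n \<noteq> z}"
  proof (intro equalityI subsetI)
    fix n assume "n \<in> {n. X n \<noteq> z}"
    then have "ab \<tau> (n div 2)"
      by (auto simp: X_eq split: if_splits)
    then have "n div 2 = e (n div 2 div 2)"
      by (auto simp: e_def ab_def)
    then have "E (2 * (n div 2 div 2) + n mod 2) = n"
      by (simp add: E_def)
    then show "n \<in> range E"
      by (metis rangeI)
  next
    fix n assume "n \<in> range E"
    then show "n \<in> {n. X n \<noteq> z}"
      using z by (auto simp: X_eq E_div e_ab)
  qed
  with X mono_E have "produces w (X \<circ> E)"
    by (rule produces.feedback)
  moreover have "X \<circ> E = interleave (ab (\<lambda>i. \<sigma> (e i))) s t"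
    by (auto simp: fun_eq_iff X_eq E_div e_ab e_div interleave_ab ab_def[of \<sigma>] E_odd
        ab_def[of "\<lambda>i. \<sigma> (e i)"])
  ultimately show "produces w (interleave (ab (\<lambda>i. \<sigma> (2 * i + (if \<tau> i then 0 else 1)))) s t)"
    by (simp add: e_def)
qed

text \<open>If no surviving block is flipped, only blocks 12 remain, and the simulated rotor
  alternates.\<close>

lemma simulates_thin_const:
  assumes "simulates w (ab \<sigma>)" "simulates w (ab \<tau>)"
    and "\<And>i. \<not> \<sigma> (2 * i + (if \<tau> i then 0 else 1))"
  shows "simulates w (ab (\<lambda>_. False))"
  using simulates_thin[OF assms(1,2)] assms(3) by simp

text \<open>The complement \<open>\<lambda>i. \<not> \<tau> i\<close> exchanges the two states of the children.\<close>

lemma simulates_thin_const':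
  assumes "simulates w (ab \<sigma>)" "simulates w (ab \<tau>)"
    and "\<And>i. \<not> \<sigma> (2 * i + (if \<tau> i then 1 else 0))"
  shows "simulates w (ab (\<lambda>_. False))"
proof (rule simulates_thin_const[OF assms(1)])
  show "simulates w (ab (\<lambda>i. \<not> \<tau> i))"
    using simulates_Not[OF assms(2)] by (simp add: ab_Not)
  show "\<not> \<sigma> (2 * i + (if \<not> \<tau> i then 0 else 1))" for i
    using assms(3)[of i] by (cases "\<tau> i") auto
qed

section \<open>One exceptional block per period\<close>

text \<open>The number \<open>2 * (i mod m) + k\<close> is below \<open>2 * m\<close>, so reduction
  subtracts \<open>m\<close> at most once.\<close>

lemma double_mod_eq_iff:
  fixes m a i k :: nat
  assumes "a < m" "k \<le> 1"
  shows "(2 * i + k) mod m = a \<longleftrightarrow> 2 * (i mod m) + k = a \<or> 2 * (i mod m) + k = a + m"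
proof -
  have "(2 * i + k) mod m = (2 * (i mod m) + k) mod m"
    by (metis mod_add_left_eq mod_mult_right_eq)
  moreover have "x mod m = a \<longleftrightarrow> x = a \<or> x = a + m" if "x < 2 * m" for x
    using that assms by (cases "x < m") (auto simp: le_mod_geq)
  moreover have "i mod m < m"
    using assms by simp
  then have "2 * (i mod m) + k < 2 * m"
    using assms by linarith
  ultimately show ?thesis
    by simp
qed

text \<open>Doubling is invertible modulo an odd \<open>m\<close>, so exactly one residue
  \<open>c\<close> satisfies 2c + 1 = a modulo \<open>m\<close>. A first thinning moves the flips
  from \<open>a\<close> to \<open>c\<close>. Children flipped at \<open>c\<close> then select the
  index 2c there, which misses \<open>a\<close>, and 2i + 1 elsewhere, which also misses
  \<open>a\<close>.\<close>

lemma simulates_alternating_odd: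
  fixes m a :: nat
  assumes sim: "simulates w (ab (\<lambda>i. i mod m = a))"
    and m: "m > 1" "odd m" and a: "0 < a" "a < m"
  shows "simulates w (ab (\<lambda>_. False))"
proof -
  obtain c where c: "c < m" "2 * c + 1 = a \<or> 2 * c + 1 = a + m"
  proof (cases "odd a")
    case True
    then obtain c where "a = 2 * c + 1"
      by (elim oddE)
    with a that[of c] show ?thesis by simp
  next
    case False
    then have "odd (a + m)"
      using m by simp
    then obtain c where "a + m = 2 * c + 1"
      by (elim oddE)
    with a that[of c] show ?thesis by simp
  qed
  \<comment> \<open>Two odd numbers cannot differ by the odd number \<open>m\<close>, so the
    solution \<open>c\<close> is unique.\<close>
  have c_iff: "2 * d + 1 = a \<or> 2 * d + 1 = a + m \<longleftrightarrow> d = c" if "d < m" for d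
  proof -
    have "2 * i + 1 \<noteq> 2 * j + 1 + m" for i j :: nat
      using \<open>odd m\<close> by (metis odd_even_add even_add odd_one even_mult_iff dvd_refl)
    from this[of c d] this[of d c] c(2) show ?thesis by auto
  qed
  have c_ne: "2 * c \<noteq> a" "2 * c \<noteq> a + m"
    using m c(2) by auto
  have mod_less: "i mod m < m" for i
    using m by simp
  \<comment> \<open>If \<open>c = a\<close>, the flips are already in place. Otherwise the exception
    of the thinning at \<open>a\<close> selects 2a, which differs from \<open>a\<close> modulo
    \<open>m\<close> since \<open>0 < a < m\<close>.\<close>
  have "simulates w (ab (\<lambda>i. i mod m = c))"
  proof (cases "c = a")
    case True
    with sim show ?thesis by simp
  next
    case False
    have "((2 * i + (if i mod m = a then 0 else 1)) mod m = a) = (i mod m = c)" for i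
      using False m a c_iff[OF mod_less, of i] by (simp add: double_mod_eq_iff)
    with simulates_thin[OF sim sim] show ?thesis by simp
  qed
  with sim show ?thesis
  proof (rule simulates_thin_const)
    fix i
    show "(2 * i + (if i mod m = c then 0 else 1)) mod m \<noteq> a"
      using a c_ne c_iff[OF mod_less, of i] by (auto simp: double_mod_eq_iff)
  qed
qed

text \<open>Reduction modulo an even \<open>m\<close> preserves parity. Selecting indices of the
  parity opposite to \<open>a\<close> avoids the flips, except possibly at i = a, where the index is
  2a or 2a + 1. Only the latter can coincide with \<open>a\<close>, namely for
  \<open>a = m - 1\<close>; then the flips are moved first.\<close>

lemma simulates_alternating_even:
  fixes m a :: nat
  assumes sim: "simulates w (ab (\<lambda>i. i mod m = a))"
    and m: "m > 2" "even m" and a: "0 < a" "a < m"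
  shows "simulates w (ab (\<lambda>_. False))"
proof -
  have parity: "(2 * i + k) mod m = b \<Longrightarrow> even (b + k)" for i b k
    using m by (metis even_add even_mult_iff dvd_mod_iff dvd_refl)
  consider "even a" | "odd a" "a \<noteq> m - 1" | "a = m - 1"
    by blast
  then show ?thesis
  proof cases
    case 1
    show ?thesis
    proof (rule simulates_thin_const[OF sim sim])
      fix i
      show "(2 * i + (if i mod m = a then 0 else 1)) mod m \<noteq> a"
        using 1 m a parity[of i 1 a] double_mod_eq_iff[of a m 0 i] by auto
    qed
  next
    case 2
    show ?thesis
    proof (rule simulates_thin_const'[OF sim sim])
      fix i
      show "(2 * i + (if i mod m = a then 1 else 0)) mod m \<noteq> a"
        using 2 m a parity[of i 0 a] double_mod_eq_iff[of a m 1 i] by auto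
    qed
  next
    case 3
    \<comment> \<open>The solutions of 2i + 1 = m - 1 modulo \<open>m\<close> are \<open>c\<close>
      and \<open>a\<close> itself; at \<open>a\<close> the thinning selects 2i instead, so only
      \<open>c\<close> remains flipped.\<close>
    obtain c where c: "2 * c + 2 = m"
    proof -
      from \<open>even m\<close> obtain k where "m = 2 * k" by (elim evenE)
      with m that[of "k - 1"] show ?thesis by simp
    qed
    have "((2 * i + (if i mod m = a then 0 else 1)) mod m = a) = (i mod m = c)" for i
      using 3 m a c by (auto simp: double_mod_eq_iff)
    with simulates_thin[OF sim sim] have sim': "simulates w (ab (\<lambda>i. i mod m = c))"
      by simp
    show ?thesis
    \<comment> \<open>Parity handles all \<open>i\<close> outside residue \<open>a\<close>. At
      \<open>a\<close> the selected index is 2c or 2c + 1 modulo \<open>m\<close>, and 2c differs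
      from \<open>c\<close> because \<open>m > 2\<close> gives \<open>c > 0\<close>.\<close>
    proof (cases "even c")
      case True
      show ?thesis
      proof (rule simulates_thin_const[OF sim' sim])
        fix i
        show "(2 * i + (if i mod m = a then 0 else 1)) mod m \<noteq> c"
          using True 3 m c parity[of i 1 c] double_mod_eq_iff[of c m 0 i] by auto
      qed
    next
      case False
      show ?thesis
      proof (rule simulates_thin_const'[OF sim' sim])
        fix i
        show "(2 * i + (if i mod m = a then 1 else 0)) mod m \<noteq> c"
          using False 3 m c parity[of i 0 c] double_mod_eq_iff[of c m 1 i] by auto
      qed
    qed
  qed
qed

section \<open>From alternation to arbitrary periodic sequences\<close>

text \<open>This enumerates what is left when each round of length \<open>N\<close> keeps its first
  \<open>k\<close> places.\<close>

lemma skip_residues: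
  fixes k N :: nat
  assumes "0 < k" "k \<le> N"
  shows "strict_mono (\<lambda>n. N * (n div k) + n mod k)"
    and "range (\<lambda>n. N * (n div k) + n mod k) = {n. n mod N < k}"
proof -
  show "strict_mono (\<lambda>n. N * (n div k) + n mod k)"
    unfolding strict_mono_Suc_iff
  proof
    fix n
    show "N * (n div k) + n mod k < N * (Suc n div k) + Suc n mod k"
      using assms by (auto simp: div_Suc mod_Suc)
  qed
  show "range (\<lambda>n. N * (n div k) + n mod k) = {n. n mod N < k}"
  proof (intro equalityI subsetI)
    fix n assume n: "n \<in> {n. n mod N < k}"
    then have "n = N * ((k * (n div N) + n mod N) div k) + (k * (n div N) + n mod N) mod k"
      using assms by simp
    then show "n \<in> range (\<lambda>n. N * (n div k) + n mod k)"
      by blast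
  next
    fix n assume "n \<in> range (\<lambda>n. N * (n div k) + n mod k)"
    moreover have "j mod k < N" "j mod k < k" for j
      using assms by (meson less_le_trans mod_less_divisor)+
    ultimately show "n \<in> {n. n mod N < k}"
      by auto
  qed
qed

lemma interleave_alternating:
  "interleave (ab (\<lambda>_. False)) s t n = (if odd n then t (n div 2) else s (n div 2))"
  by (simp add: interleave_ab) (simp add: ab_def)

text \<open>The root supplies the lowest binary digit of the residue and the subtrees the others;
  \<open>g\<close> varies because they carry the even and the odd labels.\<close>

lemma produces_power_two:
  assumes "simulates w (ab (\<lambda>_. False))"
  shows "produces w (\<lambda>n. g (n mod 2 ^ j))"
proof (induction j arbitrary: g)
  case 0
  show ?case by (simp add: produces.const)
next
  case (Suc j)
  have "produces w (interleave (ab (\<lambda>_. False))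
      (\<lambda>n. g (2 * (n mod 2 ^ j))) (\<lambda>n. g (2 * (n mod 2 ^ j) + 1)))"
    using assms Suc[of "\<lambda>i. g (2 * i)"] Suc[of "\<lambda>i. g (2 * i + 1)"]
    by (simp add: simulates_def)
  moreover have "interleave (ab (\<lambda>_. False)) (\<lambda>n. g (2 * (n mod 2 ^ j)))
      (\<lambda>n. g (2 * (n mod 2 ^ j) + 1)) = (\<lambda>n. g (n mod 2 ^ Suc j))"
  proof
    fix n :: nat
    have "n mod 2 ^ Suc j = 2 * (n div 2 mod 2 ^ j) + n mod 2"
      by (simp add: mod_mult2_eq)
    then show "interleave (ab (\<lambda>_. False)) (\<lambda>n. g (2 * (n mod 2 ^ j)))
        (\<lambda>n. g (2 * (n mod 2 ^ j) + 1)) n = g (n mod 2 ^ Suc j)"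
      unfolding interleave_alternating by (simp add: odd_iff_mod_2_eq_one)
  qed
  ultimately show ?case by simp
qed

text \<open>Pad a period of length \<open>k\<close> with a dummy to a power of two, then delete the
  dummy by feedback.\<close>

lemma produces_periodic:
  assumes alt: "simulates w (ab (\<lambda>_. False))" and "periodic s"
  shows "produces w s"
proof -
  obtain k where k: "k > 0" "\<And>n. s (n + k) = s n"
    using \<open>periodic s\<close> by (auto simp: periodic_def)
  have s_mod: "s (n mod k) = s n" for n
  proof -
    have "s (i + j * k) = s i" for i j
    proof (induction j)
      case (Suc j)
      then show ?case using k(2)[of "i + j * k"] by (simp add: ac_simps)
    qed simp
    from this[of "n mod k" "n div k"] show ?thesis by simp
  qed
  define N :: nat where "N = 2 ^ k"
  have N: "k \<le> N"
    by (simp add: N_def less_imp_le)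
  obtain z where z: "z \<notin> s ` {..<k}"
    using ex_new_if_finite infinite_UNIV_nat by blast
  define X where "X n = (if n mod N < k then s (n mod N) else z)" for n
  define e where "e n = N * (n div k) + n mod k" for n
  have "produces w X"
    unfolding X_def N_def by (rule produces_power_two[OF alt])
  moreover have "strict_mono e"
    unfolding e_def by (rule skip_residues[OF k(1) N])
  moreover have "range e = {n. X n \<noteq> z}"
    unfolding e_def skip_residues(2)[OF k(1) N] using z by (auto simp: X_def)
  ultimately have "produces w (X \<circ> e)"
    by (rule produces.feedback)
  moreover have "X \<circ> e = s"
  proof
    fix n
    have "n mod k < N" "n mod k < k"
      using k N by (meson less_le_trans mod_less_divisor)+
    then show "(X \<circ> e) n = s n"
      by (simp add: X_def e_def s_mod)
  qed
  ultimately show ?thesis by simp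
qed

section \<open>Networks of rotors\<close>

text \<open>
  A network without its graph structure: \<open>\<delta> v b\<close> is the end of the arc that leaves \<open>v\<close>
  in state \<open>b\<close>, where \<open>Inl\<close> marks a non-target vertex and \<open>Inr\<close> a target. The counters
  \<open>c\<close> record the number of departures from each vertex.
\<close>

inductive run ::
  "(nat \<Rightarrow> bool) \<Rightarrow> (nat \<Rightarrow> bool \<Rightarrow> nat + nat) \<Rightarrow> nat + nat \<Rightarrow> (nat \<Rightarrow> nat) \<Rightarrow> nat \<Rightarrow> (nat \<Rightarrow> nat) \<Rightarrow> bool"
  for w \<delta> where
  target: "run w \<delta> (Inr x) c x c"
| step: "run w \<delta> (\<delta> v (w (c v))) (c(v := Suc (c v))) x c' \<Longrightarrow> run w \<delta> (Inl v) c x c'"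

text \<open>Unlike \<open>run\<close>, this follows arbitrary arcs, as the reachability condition on
  a network does.\<close>

inductive reaches :: "(nat \<Rightarrow> bool \<Rightarrow> nat + nat) \<Rightarrow> nat + nat \<Rightarrow> bool" for \<delta> where
  target: "reaches \<delta> (Inr x)"
| step: "reaches \<delta> (\<delta> v b) \<Longrightarrow> reaches \<delta> (Inl v)"

lemma run_reaches: "run w \<delta> u c x c' \<Longrightarrow> reaches \<delta> u"
  by (induction rule: run.induct) (auto intro: reaches.intros)

text \<open>Disjoint intervals keep the non-target vertices of different subtrees apart, while all
  subtrees share the targets.\<close>

definition nodes :: "nat \<Rightarrow> nat \<Rightarrow> (nat + nat) set" where
  "nodes N M = Inl ` {N..<M} \<union> range Inr"

lemma nodes_simps [simp]: "Inr x \<in> nodes N M" "Inl v \<in> nodes N M \<longleftrightarrow> N \<le> v \<and> v < M"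
  by (auto simp: nodes_def)

lemma nodes_mono: "u \<in> nodes N M \<Longrightarrow> N' \<le> N \<Longrightarrow> M \<le> M' \<Longrightarrow> u \<in> nodes N' M'"
  by (auto simp: nodes_def)

text \<open>\<open>C n\<close> gives the counters before pass number \<open>n\<close>; they persist
  from one pass to the next.\<close>

definition machine ::
  "(nat \<Rightarrow> bool) \<Rightarrow> nat \<Rightarrow> nat \<Rightarrow> (nat \<Rightarrow> bool \<Rightarrow> nat + nat) \<Rightarrow> nat + nat \<Rightarrow> (nat \<Rightarrow> nat) \<Rightarrow> bool"
where
  "machine w N M \<delta> u s \<longleftrightarrow>
     N \<le> M \<and> u \<in> nodes N M \<and>
     (\<forall>v\<in>{N..<M}. \<forall>b. \<delta> v b \<in> nodes N M) \<and>
     (\<forall>v\<in>{N..<M}. reaches \<delta> (Inl v)) \<and>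
     (\<exists>C. C 0 = (\<lambda>_. 0) \<and> (\<forall>n. run w \<delta> u (C n) (s n) (C (Suc n))))"

text \<open>A run never leaves a closed interval, so it can take place inside a larger network and
  leaves all counters outside unchanged.\<close>

lemma run_frame:
  assumes "run w \<delta> u c x c'"
    and closed: "\<forall>v\<in>{N..<M}. \<forall>b. \<delta> v b \<in> nodes N M"
    and agree: "\<forall>v\<in>{N..<M}. \<delta>' v = \<delta> v"
    and "u \<in> nodes N M" "\<forall>v\<in>{N..<M}. d v = c v"
  shows "run w \<delta>' u d x (\<lambda>v. if v \<in> {N..<M} then c' v else d v)"
  using assms(1,4,5)
proof (induction arbitrary: d rule: run.induct)
  case (target x c)
  then have "(\<lambda>v. if v \<in> {N..<M} then c v else d v) = d"
    by auto
  then show ?case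
    by (simp only: run.target)
next
  case (step v c x c')
  then have v: "v \<in> {N..<M}" by simp
  have "run w \<delta>' (\<delta> v (w (c v))) (d(v := Suc (c v))) x
      (\<lambda>u. if u \<in> {N..<M} then c' u else (d(v := Suc (c v))) u)"
    by (rule step.IH) (use closed v step.prems in auto)
  also have "(\<lambda>u. if u \<in> {N..<M} then c' u else (d(v := Suc (c v))) u) =
      (\<lambda>u. if u \<in> {N..<M} then c' u else d u)"
    using v by auto
  finally show ?case
    using v step.prems agree by (intro run.step) (simp add: fun_upd_def)
qed

lemma reaches_frame:
  assumes "reaches \<delta> u"
    and closed: "\<forall>v\<in>{N..<M}. \<forall>b. \<delta> v b \<in> nodes N M"
    and agree: "\<forall>v\<in>{N..<M}. \<delta>' v = \<delta> v"
    and "u \<in> nodes N M"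
  shows "reaches \<delta>' u"
  using assms(1,4)
proof (induction rule: reaches.induct)
  case (step v b)
  then have "\<delta>' v = \<delta> v" "reaches \<delta>' (\<delta> v b)"
    using closed agree by auto
  then show ?case
    by (metis reaches.step)
qed (rule reaches.target)

lemma machine_const: "machine w N N \<delta> (Inr x) (\<lambda>_. x)"
  unfolding machine_def by (auto intro!: exI[of _ "\<lambda>_ _. 0"] run.target)

text \<open>The root is \<open>N\<close>; the subtrees occupy \<open>{Suc N..<M}\<close> and
  \<open>{M..<M'}\<close>.\<close>

lemma machine_split:
  assumes s: "machine w (Suc N) M \<delta>\<^sub>1 u\<^sub>1 s" and t: "machine w M M' \<delta>\<^sub>2 u\<^sub>2 t"
  shows "machine w N M'
    (\<lambda>v b. if v = N then if b then u\<^sub>2 else u\<^sub>1 else if v < M then \<delta>\<^sub>1 v b else \<delta>\<^sub>2 v b)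
    (Inl N) (interleave w s t)"
    (is "machine w N M' ?\<delta> _ _")
proof -
  have le: "N < M" "M \<le> M'" and u: "u\<^sub>1 \<in> nodes (Suc N) M" "u\<^sub>2 \<in> nodes M M'"
    and cl1: "\<forall>v\<in>{Suc N..<M}. \<forall>b. \<delta>\<^sub>1 v b \<in> nodes (Suc N) M"
    and cl2: "\<forall>v\<in>{M..<M'}. \<forall>b. \<delta>\<^sub>2 v b \<in> nodes M M'"
    and re1: "\<forall>v\<in>{Suc N..<M}. reaches \<delta>\<^sub>1 (Inl v)"
    and re2: "\<forall>v\<in>{M..<M'}. reaches \<delta>\<^sub>2 (Inl v)"
    using s t by (auto simp: machine_def)
  obtain C\<^sub>1 where C1: "C\<^sub>1 0 = (\<lambda>_. 0)" "\<And>n. run w \<delta>\<^sub>1 u\<^sub>1 (C\<^sub>1 n) (s n) (C\<^sub>1 (Suc n))"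
    using s by (auto simp: machine_def)
  obtain C\<^sub>2 where C2: "C\<^sub>2 0 = (\<lambda>_. 0)" "\<And>n. run w \<delta>\<^sub>2 u\<^sub>2 (C\<^sub>2 n) (t n) (C\<^sub>2 (Suc n))"
    using t by (auto simp: machine_def)
  have ag1: "\<forall>v\<in>{Suc N..<M}. ?\<delta> v = \<delta>\<^sub>1 v" and ag2: "\<forall>v\<in>{M..<M'}. ?\<delta> v = \<delta>\<^sub>2 v"
    using le by auto
  \<comment> \<open>After \<open>n\<close> passes the root has been left \<open>n\<close> times, and
    each subtree has made as many passes as \<open>w\<close> has sent to it.\<close>
  define D where "D n v = (if v = N then n
      else if v \<in> {Suc N..<M} then C\<^sub>1 (count (\<lambda>k. \<not> w k) n) v
      else if v \<in> {M..<M'} then C\<^sub>2 (count w n) v else 0)" for n v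
  have D0: "D 0 = (\<lambda>_. 0)"
    by (auto simp: D_def C1 C2)
  have D_run: "run w ?\<delta> (Inl N) (D n) (interleave w s t n) (D (Suc n))" for n
  proof (rule run.step)
    have DN: "D n N = n" by (simp add: D_def)
    show "run w ?\<delta> (?\<delta> N (w (D n N))) ((D n)(N := Suc (D n N))) (interleave w s t n) (D (Suc n))"
    proof (cases "w n")
      case True
      have "run w ?\<delta> u\<^sub>2 ((D n)(N := Suc n)) (t (count w n))
          (\<lambda>v. if v \<in> {M..<M'} then C\<^sub>2 (Suc (count w n)) v else ((D n)(N := Suc n)) v)"
        by (rule run_frame[OF C2(2) cl2 ag2]) (use u le in \<open>auto simp: D_def\<close>)
      also have "(\<lambda>v. if v \<in> {M..<M'} then C\<^sub>2 (Suc (count w n)) v else ((D n)(N := Suc n)) v) =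
          D (Suc n)"
        using True le by (auto simp: fun_eq_iff D_def count_Suc)
      finally show ?thesis
        using True by (simp add: DN interleave_def fun_upd_def)
    next
      case False
      let ?k = "count (\<lambda>k. \<not> w k) n"
      have "run w ?\<delta> u\<^sub>1 ((D n)(N := Suc n)) (s ?k)
          (\<lambda>v. if v \<in> {Suc N..<M} then C\<^sub>1 (Suc ?k) v else ((D n)(N := Suc n)) v)"
        by (rule run_frame[OF C1(2) cl1 ag1]) (use u le in \<open>auto simp: D_def\<close>)
      also have "(\<lambda>v. if v \<in> {Suc N..<M} then C\<^sub>1 (Suc ?k) v else ((D n)(N := Suc n)) v) =
          D (Suc n)"
        using False le by (auto simp: fun_eq_iff D_def count_Suc)
      finally show ?thesis
        using False by (simp add: DN interleave_def fun_upd_def)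
    qed
  qed
  have "reaches ?\<delta> (Inl v)" if "v \<in> {N..<M'}" for v
  proof -
    consider "v = N" | "v \<in> {Suc N..<M}" | "v \<in> {M..<M'}"
      using \<open>v \<in> {N..<M'}\<close> by fastforce
    then show ?thesis
    proof cases
      case 1
      with D_run show ?thesis by (blast intro: run_reaches)
    next
      case 2
      then show ?thesis
        by (intro reaches_frame[OF _ cl1 ag1]) (use re1 in auto)
    next
      case 3
      then show ?thesis
        by (intro reaches_frame[OF _ cl2 ag2]) (use re2 in auto)
    qed
  qed
  moreover have "?\<delta> v b \<in> nodes N M'" if "v \<in> {N..<M'}" for v b
    using that le u cl1 cl2
    by (auto intro: nodes_mono[of _ "Suc N" M] nodes_mono[of _ M M'])
  ultimately show ?thesis
    using le D0 D_run unfolding machine_def by auto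
qed

text \<open>The run is unchanged up to its last arc; if that arc led to \<open>z\<close>, the
  particle goes on from \<open>u\<close> with the counters reached so far.\<close>

lemma run_feedback:
  fixes u :: "nat + nat"
  assumes "run w \<delta> v c x c'" and "v \<noteq> Inr z"
  defines "\<delta>' \<equiv> \<lambda>v b. if \<delta> v b = Inr z then u else \<delta> v b"
  assumes "if x = z then run w \<delta>' u c' y d else y = x \<and> d = c'"
  shows "run w \<delta>' v c y d"
  using assms(1,2,4)
proof (induction rule: run.induct)
  case (target x c)
  then show ?case by (auto intro: run.target)
next
  case (step v c x c')
  have "run w \<delta>' (\<delta>' v (w (c v))) (c(v := Suc (c v))) y d"
  proof (cases "\<delta> v (w (c v)) = Inr z")
    case True
    with step.hyps have "x = z" "c' = c(v := Suc (c v))"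
      by (auto elim: run.cases)
    with True step.prems show ?thesis by (simp add: \<delta>'_def)
  next
    case False
    then have "\<delta>' v (w (c v)) = \<delta> v (w (c v))"
      by (simp add: \<delta>'_def)
    moreover have "run w \<delta>' (\<delta> v (w (c v))) (c(v := Suc (c v))) y d"
      using False step.prems by (intro step.IH)
    ultimately show ?thesis by simp
  qed
  then show ?case by (rule run.step)
qed

lemma machine_feedback:
  assumes s: "machine w N M \<delta> u s" and e: "strict_mono e" "range e = {n. s n \<noteq> z}"
  shows "machine w N M (\<lambda>v b. if \<delta> v b = Inr z then u else \<delta> v b) u (s \<circ> e)"
    (is "machine w N M ?\<delta> _ _")
proof -
  obtain C where C: "C 0 = (\<lambda>_. 0)" "\<And>n. run w \<delta> u (C n) (s n) (C (Suc n))"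
    using s by (auto simp: machine_def)
  have e_ne: "s (e n) \<noteq> z" for n
    using e by blast
  have "u \<noteq> Inr z"
  proof
    assume "u = Inr z"
    with C(2)[of "e 0"] have "s (e 0) = z"
      by (auto elim: run.cases)
    with e_ne show False by blast
  qed
  \<comment> \<open>Passes \<open>i\<close> to \<open>j - 1\<close> end in \<open>z\<close>, so with
    pass \<open>j\<close> they join into one.\<close>
  have run_skip: "run w ?\<delta> u (C i) (s j) (C (Suc j))"
    if "i \<le> j" "s j \<noteq> z" "\<forall>k. i \<le> k \<and> k < j \<longrightarrow> s k = z" for i j
    using that
  proof (induction rule: inc_induct)
    case base
    then show ?case
      by (intro run_feedback[OF C(2) \<open>u \<noteq> Inr z\<close>]) simp
  next
    case (step i)
    then show ?case
      by (intro run_feedback[OF C(2) \<open>u \<noteq> Inr z\<close>]) auto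
  qed
  define D where "D n = (case n of 0 \<Rightarrow> C 0 | Suc n \<Rightarrow> C (Suc (e n)))" for n
  have gap: "s k = z" if "\<forall>i<n. e i < k" "k < e n" for k n
  proof (rule ccontr)
    assume "s k \<noteq> z"
    then obtain i where "k = e i"
      using e by blast
    with that e(1) have "i < n"
      by (simp add: strict_mono_less)
    with that \<open>k = e i\<close> show False
      by blast
  qed
  have D_run: "run w ?\<delta> u (D n) (s (e n)) (D (Suc n))" for n
  proof (cases n)
    case 0
    then show ?thesis
      using gap[of 0] e_ne by (auto simp: D_def intro!: run_skip)
  next
    case (Suc m)
    have "\<forall>i<n. e i < k" if "Suc (e m) \<le> k" for k
      using that e(1) Suc by (metis Suc_le_lessD le_less_trans less_Suc_eq_le strict_mono_less_eq)
    moreover have "Suc (e m) \<le> e n"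
      using Suc e(1) by (simp add: strict_monoD Suc_leI)
    ultimately show ?thesis
      using Suc e_ne gap[of n] by (auto simp: D_def intro!: run_skip)
  qed
  \<comment> \<open>A path that used to end in \<open>z\<close> now arrives at \<open>u\<close>, so
    reachability is needed there first.\<close>
  have "reaches ?\<delta> u"
    using D_run by (rule run_reaches)
  have "reaches ?\<delta> v" if "reaches \<delta> v" "v \<noteq> Inr z" for v
    using that
  proof (induction rule: reaches.induct)
    case (step v b)
    then have "reaches ?\<delta> (?\<delta> v b)"
      using \<open>reaches ?\<delta> u\<close> by auto
    then show ?case by (rule reaches.step)
  qed (rule reaches.target)
  moreover have "D 0 = (\<lambda>_. 0)"
    by (simp add: D_def C)
  ultimately show ?thesis
    using s D_run unfolding machine_def by auto
qed

text \<open>With \<open>N\<close> arbitrary, the second subtree can be numbered from where the first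
  one ends.\<close>

lemma produces_machine:
  assumes "produces w s"
  shows "\<exists>M \<delta> u. machine w N M \<delta> u s"
  using assms
proof (induction arbitrary: N rule: produces.induct)
  case (const x)
  show ?case by (blast intro: machine_const)
next
  case (split s t)
  then show ?case by (meson machine_split)
next
  case (feedback s e z)
  then obtain M \<delta> u where "machine w N M \<delta> u s"
    by blast
  from machine_feedback[OF this feedback.hyps(2,3)] show ?case
    by blast
qed

section \<open>The digraph of a network\<close>

definition node_code :: "nat + nat \<Rightarrow> nat" where
  "node_code u = (case u of Inl v \<Rightarrow> 2 * v | Inr x \<Rightarrow> 2 * x + 1)"

lemma node_code_simps [simp]: "node_code (Inl v) = 2 * v" "node_code (Inr x) = 2 * x + 1"
  by (simp_all add: node_code_def)

text \<open>Restricting to labels that occur keeps the vertex set finite; the root counts too, as it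
  may itself be a target.\<close>

definition outputs :: "nat \<Rightarrow> (nat \<Rightarrow> bool \<Rightarrow> nat + nat) \<Rightarrow> nat + nat \<Rightarrow> nat set" where
  "outputs M \<delta> u = {x. u = Inr x \<or> (\<exists>v<M. \<exists>b. \<delta> v b = Inr x)}"

lemma outputsI: "v < M \<Longrightarrow> \<delta> v b = Inr x \<Longrightarrow> x \<in> outputs M \<delta> u"
  unfolding outputs_def by blast

definition target_codes :: "nat \<Rightarrow> (nat \<Rightarrow> bool \<Rightarrow> nat + nat) \<Rightarrow> nat + nat \<Rightarrow> nat set" where
  "target_codes M \<delta> u = (\<lambda>x. 2 * x + 1) ` outputs M \<delta> u"

text \<open>The vertex with code \<open>2 * v\<close> has the two out-arcs \<open>2 * v\<close> and
  \<open>2 * v + 1\<close>, for the states \<open>False\<close> and \<open>True\<close>.\<close>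

definition network_digraph ::
  "nat \<Rightarrow> (nat \<Rightarrow> bool \<Rightarrow> nat + nat) \<Rightarrow> nat + nat \<Rightarrow> (nat, nat) pre_digraph"
where
  "network_digraph M \<delta> u =
     \<lparr>verts = (\<lambda>v. 2 * v) ` {..<M} \<union> target_codes M \<delta> u,
      arcs = {..<2 * M},
      tail = \<lambda>e. 2 * (e div 2),
      head = \<lambda>e. node_code (\<delta> (e div 2) (odd e))\<rparr>"

definition network_rotor :: "(nat \<Rightarrow> bool) \<Rightarrow> nat \<Rightarrow> nat \<Rightarrow> nat" where
  "network_rotor w v n = v + of_bool (w n)"

lemma finite_outputs: "finite (outputs M \<delta> u)"
proof -
  have "Inr ` outputs M \<delta> u \<subseteq> insert u (\<Union>v<M. range (\<delta> v))"
  proof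
    fix y :: "nat + nat" assume "y \<in> Inr ` outputs M \<delta> u"
    then have "u = y \<or> (\<exists>v<M. \<exists>b. \<delta> v b = y)"
      unfolding outputs_def by blast
    then show "y \<in> insert u (\<Union>v<M. range (\<delta> v))"
      by blast
  qed
  then have "finite (Inr ` outputs M \<delta> u :: (nat + nat) set)"
    by (rule finite_subset) simp
  then show ?thesis
    by (rule finite_imageD) simp
qed

lemma node_code_in_verts:
  assumes "v \<in> nodes 0 M" "\<And>x. v = Inr x \<Longrightarrow> x \<in> outputs M \<delta> u"
  shows "node_code v \<in> verts (network_digraph M \<delta> u)"
  using assms by (cases v) (auto simp: network_digraph_def target_codes_def)

lemma fin_digraph_network:
  assumes "\<forall>v\<in>{0..<M}. \<forall>b. \<delta> v b \<in> nodes 0 M"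
  shows "fin_digraph (network_digraph M \<delta> u)"
proof
  fix e assume "e \<in> arcs (network_digraph M \<delta> u)"
  then have e: "e div 2 < M"
    by (auto simp: network_digraph_def)
  then show "tail (network_digraph M \<delta> u) e \<in> verts (network_digraph M \<delta> u)"
    by (simp add: network_digraph_def)
  have "node_code (\<delta> (e div 2) (odd e)) \<in> verts (network_digraph M \<delta> u)"
    using e assms by (intro node_code_in_verts) (auto intro: outputsI)
  then show "head (network_digraph M \<delta> u) e \<in> verts (network_digraph M \<delta> u)"
    by (simp add: network_digraph_def)
qed (auto simp: network_digraph_def target_codes_def finite_outputs)

lemma reaches_network:
  assumes closed: "\<forall>v\<in>{0..<M}. \<forall>b. \<delta> v b \<in> nodes 0 M"
    and "reaches \<delta> v" "v \<in> nodes 0 M" "\<And>x. v = Inr x \<Longrightarrow> x \<in> outputs M \<delta> u"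
  shows "\<exists>t\<in>target_codes M \<delta> u. node_code v \<rightarrow>\<^sup>*\<^bsub>network_digraph M \<delta> u\<^esub> t"
  using assms(2-4)
proof (induction rule: reaches.induct)
  case (target x)
  interpret fin_digraph "network_digraph M \<delta> u"
    by (rule fin_digraph_network[OF closed])
  have "node_code (Inr x) \<in> verts (network_digraph M \<delta> u)"
    using target by (intro node_code_in_verts) auto
  then have "node_code (Inr x) \<rightarrow>\<^sup>*\<^bsub>network_digraph M \<delta> u\<^esub> node_code (Inr x)"
    by (rule reachable_refl)
  then show ?case
    using target by (auto simp: target_codes_def)
next
  case (step v b)
  interpret fin_digraph "network_digraph M \<delta> u"
    by (rule fin_digraph_network[OF closed])
  from step have v: "v < M" by simp
  then obtain t where t: "t \<in> target_codes M \<delta> u"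
    "node_code (\<delta> v b) \<rightarrow>\<^sup>*\<^bsub>network_digraph M \<delta> u\<^esub> t"
    using step.IH closed outputsI[OF v] by (metis atLeastLessThan_iff le0)
  have "node_code (Inl v) \<rightarrow>\<^bsub>network_digraph M \<delta> u\<^esub> node_code (\<delta> v b)"
    using v
    by (intro dominatesI[of "2 * v + of_bool b"]) (auto simp: network_digraph_def arc_to_ends_def)
  then show ?case
    using t by (blast intro: adj_reachable_trans)
qed

lemma rotor_network_network:
  assumes closed: "\<forall>v\<in>{0..<M}. \<forall>b. \<delta> v b \<in> nodes 0 M"
    and reach: "\<forall>v\<in>{0..<M}. reaches \<delta> (Inl v)"
    and u: "u \<in> nodes 0 M" and w: "periodic w"
  shows "rotor_network (network_digraph M \<delta> u) (node_code u) (target_codes M \<delta> u)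
    (network_rotor w)"
proof -
  let ?G = "network_digraph M \<delta> u"
  interpret fin_digraph ?G
    by (rule fin_digraph_network[OF closed])
  have nontarget: "\<exists>i<M. v = 2 * i" if "v \<in> verts ?G - target_codes M \<delta> u" for v
    using that by (auto simp: network_digraph_def)
  show ?thesis
  proof
    show "node_code u \<in> verts ?G"
      using u by (rule node_code_in_verts) (simp add: outputs_def)
    show "target_codes M \<delta> u \<subseteq> verts ?G"
      by (simp add: network_digraph_def)
    show "out_degree ?G t = 0" if "t \<in> target_codes M \<delta> u" for t
    proof -
      have "odd t"
        using that by (auto simp: target_codes_def)
      then have "out_arcs ?G t = {}"
        by (auto simp: out_arcs_def network_digraph_def)
      then show ?thesis
        by (simp add: out_degree_def)
    qed
    show "\<exists>t\<in>target_codes M \<delta> u. v \<rightarrow>\<^sup>*\<^bsub>?G\<^esub> t" if "v \<in> verts ?G - target_codes M \<delta> u" for v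
      using nontarget[OF that] reaches_network[OF closed, of "Inl (v div 2)" u] reach by auto
    show "network_rotor w v n \<in> out_arcs ?G v" if "v \<in> verts ?G - target_codes M \<delta> u" for v n
      using nontarget[OF that] by (auto simp: network_rotor_def network_digraph_def)
    show "periodic (network_rotor w v)" for v
      using w by (auto simp: periodic_def network_rotor_def)
  qed
qed

section \<open>Particle walks and hitting times\<close>

text \<open>Each step of the run is one time step. Only counters at even codes are compared, since
  targets have odd codes.\<close>

lemma rotor_walk_run:
  fixes M \<delta> u w
  defines "walk \<equiv> rotor_walk (network_digraph M \<delta> u) (node_code u) (target_codes M \<delta> u)
    (network_rotor w)"
  assumes closed: "\<forall>v\<in>{0..<M}. \<forall>b. \<delta> v b \<in> nodes 0 M"
    and "run w \<delta> v c x c'"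
    and "v \<in> nodes 0 M" "\<And>x. v = Inr x \<Longrightarrow> x \<in> outputs M \<delta> u"
    and "walk t = (node_code v, d)" "\<And>i. d (2 * i) = c i"
  shows "\<exists>t'\<ge>t. \<exists>d'. walk t' = (2 * x + 1, d') \<and> (\<forall>i. d' (2 * i) = c' i) \<and>
    fst (walk t') \<in> target_codes M \<delta> u \<and>
    (\<forall>j. t \<le> j \<and> j < t' \<longrightarrow> fst (walk j) \<notin> target_codes M \<delta> u)"
  using assms(3-)
proof (induction arbitrary: t d rule: run.induct)
  case (target x c)
  then show ?case
    by (intro exI[of _ t] conjI) (auto simp: target_codes_def)
next
  case (step v c x c')
  then have v: "v < M" by simp
  have nt: "2 * v \<notin> target_codes M \<delta> u"
    by (auto simp: target_codes_def) presburger
  have "walk (Suc t) = (node_code (\<delta> v (w (c v))), d(2 * v := Suc (c v)))"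
    using step.prems nt unfolding walk_def
    by (simp add: network_digraph_def network_rotor_def)
  then have "\<exists>t'\<ge>Suc t. \<exists>d'. walk t' = (2 * x + 1, d') \<and> (\<forall>i. d' (2 * i) = c' i) \<and>
      fst (walk t') \<in> target_codes M \<delta> u \<and>
      (\<forall>j. Suc t \<le> j \<and> j < t' \<longrightarrow> fst (walk j) \<notin> target_codes M \<delta> u)"
  proof (rule step.IH[rotated 2])
    show "(d(2 * v := Suc (c v))) (2 * i) = (c(v := Suc (c v))) i" for i
      using step.prems by simp
    show "\<delta> v (w (c v)) \<in> nodes 0 M"
      using closed v by simp
    show "y \<in> outputs M \<delta> u" if "\<delta> v (w (c v)) = Inr y" for y
      using v that by (rule outputsI)
  qed
  then obtain t' d' where t': "t' \<ge> Suc t" "walk t' = (2 * x + 1, d')"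
    "\<forall>i. d' (2 * i) = c' i" "fst (walk t') \<in> target_codes M \<delta> u"
    "\<forall>j. Suc t \<le> j \<and> j < t' \<longrightarrow> fst (walk j) \<notin> target_codes M \<delta> u"
    by blast
  have "fst (walk j) \<notin> target_codes M \<delta> u" if "t \<le> j" "j < t'" for j
    using that t'(5) nt step.prems(3) by (cases "j = t") auto
  with t' show ?case
    by (intro exI[of _ t'] conjI exI[of _ d']) auto
qed

text \<open>For a time \<open>t\<close> with \<open>P t\<close>, take the least \<open>n\<close>
  with \<open>t \<le> \<tau> n\<close>; then \<open>t\<close> lies after all earlier values, and the
  gap condition forces equality.\<close>

lemma range_strict_mono:
  fixes \<tau> :: "nat \<Rightarrow> nat"
  assumes "\<forall>n. \<tau> n < \<tau> (Suc n)" "\<forall>n. P (\<tau> n)" "\<forall>j<\<tau> 0. \<not> P j"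
    and "\<forall>n j. \<tau> n < j \<and> j < \<tau> (Suc n) \<longrightarrow> \<not> P j"
  shows "strict_mono \<tau>" "range \<tau> = {t. P t}"
proof -
  show mono: "strict_mono \<tau>"
    using assms(1) by (simp add: strict_mono_Suc_iff)
  have "t \<in> range \<tau>" if "P t" for t
  proof -
    define n where "n = (LEAST n. t \<le> \<tau> n)"
    have "t \<le> \<tau> t"
      using mono by (rule strict_mono_imp_increasing)
    then have n: "t \<le> \<tau> n"
      unfolding n_def by (rule LeastI)
    have less: "\<tau> k < t" if "k < n" for k
      using not_less_Least[of k "\<lambda>n. t \<le> \<tau> n"] that by (simp add: n_def)
    have "\<not> t < \<tau> n"
    proof (cases n)
      case 0
      with that assms(3) show ?thesis by blast
    next
      case (Suc k)
      with that assms(4) less[of k] show ?thesis by blast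
    qed
    with n have "t = \<tau> n" by simp
    then show ?thesis by blast
  qed
  with assms(2) show "range \<tau> = {t. P t}" by blast
qed

lemma machine_hitting_sequence:
  assumes "machine w 0 M \<delta> u s"
  shows "hitting_sequence (network_digraph M \<delta> u) (node_code u) (target_codes M \<delta> u)
    (network_rotor w) (\<lambda>n. 2 * s n + 1)"
proof -
  define walk where "walk = rotor_walk (network_digraph M \<delta> u) (node_code u)
    (target_codes M \<delta> u) (network_rotor w)"
  define T where "T t \<longleftrightarrow> fst (walk t) \<in> target_codes M \<delta> u" for t
  have u: "u \<in> nodes 0 M" and closed: "\<forall>v\<in>{0..<M}. \<forall>b. \<delta> v b \<in> nodes 0 M"
    using assms by (auto simp: machine_def)
  obtain C where C: "C 0 = (\<lambda>_. 0)" "\<And>n. run w \<delta> u (C n) (s n) (C (Suc n))"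
    using assms by (auto simp: machine_def)
  define hit where "hit n t \<longleftrightarrow> T t \<and> fst (walk t) = 2 * s n + 1 \<and>
    (\<forall>i. snd (walk t) (2 * i) = C (Suc n) i)" for n t
  have next_hit: "\<exists>t'\<ge>t. hit n t' \<and> (\<forall>j. t \<le> j \<and> j < t' \<longrightarrow> \<not> T j)"
    if "walk t = (node_code u, d)" "\<And>i. d (2 * i) = C n i" for n t d
  proof -
    have "\<exists>t'\<ge>t. \<exists>d'. walk t' = (2 * s n + 1, d') \<and> (\<forall>i. d' (2 * i) = C (Suc n) i) \<and>
        fst (walk t') \<in> target_codes M \<delta> u \<and>
        (\<forall>j. t \<le> j \<and> j < t' \<longrightarrow> fst (walk j) \<notin> target_codes M \<delta> u)"
      unfolding walk_def
    proof (rule rotor_walk_run[OF closed C(2) u])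
      show "rotor_walk (network_digraph M \<delta> u) (node_code u) (target_codes M \<delta> u)
          (network_rotor w) t = (node_code u, d)"
        using that(1) by (simp add: walk_def)
    qed (use that(2) in \<open>auto simp: outputs_def\<close>)
    then obtain t' d' where t': "t \<le> t'" "walk t' = (2 * s n + 1, d')"
      "\<forall>i. d' (2 * i) = C (Suc n) i" "T t'" "\<forall>j. t \<le> j \<and> j < t' \<longrightarrow> \<not> T j"
      unfolding T_def by blast
    then have "hit n t'"
      by (simp add: hit_def)
    with t' show ?thesis by blast
  qed
  \<comment> \<open>The clause for \<open>n = 0\<close> excludes hits before the first chosen
    time.\<close>
  have "\<exists>\<tau>. \<forall>n. (hit n (\<tau> n) \<and> (n = 0 \<longrightarrow> (\<forall>j<\<tau> n. \<not> T j))) \<and>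
      (\<tau> n < \<tau> (Suc n) \<and> (\<forall>j. \<tau> n < j \<and> j < \<tau> (Suc n) \<longrightarrow> \<not> T j))"
  proof (rule dependent_nat_choice)
    show "\<exists>t. hit 0 t \<and> (0 = 0 \<longrightarrow> (\<forall>j<t. \<not> T j))"
      using next_hit[of 0 "\<lambda>_. 0" 0] by (auto simp: walk_def C)
  next
    fix t n assume *: "hit n t \<and> (n = 0 \<longrightarrow> (\<forall>j<t. \<not> T j))"
    \<comment> \<open>The return to the source takes one step and changes no counter.\<close>
    then have "walk (Suc t) = (node_code u, snd (walk t))"
      by (auto simp: hit_def T_def walk_def split: prod.splits)
    from next_hit[OF this] * obtain t' where "t' \<ge> Suc t" "hit (Suc n) t'"
      "\<forall>j. Suc t \<le> j \<and> j < t' \<longrightarrow> \<not> T j"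
      unfolding hit_def by blast
    then show "\<exists>t'. (hit (Suc n) t' \<and> (Suc n = 0 \<longrightarrow> (\<forall>j<t'. \<not> T j))) \<and>
        (t < t' \<and> (\<forall>j. t < j \<and> j < t' \<longrightarrow> \<not> T j))"
      by (intro exI[of _ t']) auto
  qed
  then obtain \<tau> where \<tau>: "\<forall>n. hit n (\<tau> n)" "\<forall>j<\<tau> 0. \<not> T j"
    "\<forall>n. \<tau> n < \<tau> (Suc n)" "\<forall>n j. \<tau> n < j \<and> j < \<tau> (Suc n) \<longrightarrow> \<not> T j"
    by metis
  have "\<forall>n. T (\<tau> n)"
    using \<tau>(1) by (simp add: hit_def)
  note mono = range_strict_mono[OF \<tau>(3) this \<tau>(2,4)]
  have "2 * s n + 1 = fst (walk (\<tau> n))" for n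
    using \<tau>(1) by (simp add: hit_def)
  with mono show ?thesis
    unfolding hitting_sequence_def particle_position_def walk_def[symmetric] T_def
    by (intro exI[of _ \<tau>]) simp
qed

section \<open>Modelling and universality\<close>

lemma models_if_produces:
  assumes r: "periodic r" "range r = {1, 2}" and "produces (\<lambda>n. r n = 2) r'"
  shows "models r r'"
proof -
  let ?w = "\<lambda>n. r n = 2"
  obtain M \<delta> u where m: "machine ?w 0 M \<delta> u r'"
    using produces_machine[OF assms(3)] by blast
  let ?G = "network_digraph M \<delta> u" and ?T = "target_codes M \<delta> u" and ?h = "\<lambda>n. 2 * r' n + 1"
  have "periodic ?w"
    using r(1) by (auto simp: periodic_def)
  then have net: "rotor_network ?G (node_code u) ?T (network_rotor ?w)"
    using m by (intro rotor_network_network) (auto simp: machine_def)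
  have "homogeneous ?G ?T (network_rotor ?w) r"
    unfolding homogeneous_def
  proof
    fix v assume v: "v \<in> verts ?G - ?T"
    show "\<exists>\<phi>. inj_on \<phi> (range r) \<and> \<phi> ` range r \<subseteq> out_arcs ?G v \<and>
        (\<forall>n. network_rotor ?w v n = \<phi> (r n))"
    proof (intro exI conjI allI)
      show "inj_on (\<lambda>q. v + of_bool (q = 2)) (range r)"
        by (auto simp: r(2))
      show "(\<lambda>q. v + of_bool (q = 2)) ` range r \<subseteq> out_arcs ?G v"
        using rotor_network.rotor_out_arc[OF net v] by (auto simp: network_rotor_def)
      show "network_rotor ?w v n = v + of_bool (r n = 2)" for n
        by (simp add: network_rotor_def)
    qed
  qed
  \<comment> \<open>Halving decodes the target code \<open>2 * x + 1\<close> to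
    \<open>x\<close>.\<close>
  moreover have "rotor_equiv ?h r'"
    unfolding rotor_equiv_def
    by (intro exI[of _ "\<lambda>x. x div 2"]) (auto simp: inj_on_def)
  ultimately show ?thesis
    using net machine_hitting_sequence[OF m] unfolding models_def by blast
qed

theorem theorem8p3:
  fixes r :: "nat \<Rightarrow> nat"
  assumes "ab_ba r"
    and "block_count r (1, 2) > 1"
    and "block_count r (2, 1) = 1"
  shows "universal r"
proof -
  define p where "p = fundamental_period r"
  define m where "m = p div 2"
  have r: "periodic r" "range r = {1, 2}" "r 0 = 1"
    and "even p" and blocks: "\<And>k. block r k = (1, 2) \<or> block r k = (2, 1)"
    using assms(1) by (auto simp: ab_ba_def two_state_def rotor_type_def p_def)
  have "\<exists>p>0. \<forall>n. r (n + p) = r n"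
    using r(1) by (simp add: periodic_def)
  from LeastI_ex[OF this] have p: "p > 0" "\<And>n. r (n + p) = r n"
    by (simp_all add: p_def fundamental_period_def)
  have "p = 2 * m"
    using \<open>even p\<close> by (simp add: m_def)
  then have m: "m > 0"
    using p(1) by simp
  have block_period: "block r (k + m) = block r k" for k
    using p(2)[of "2 * k"] p(2)[of "2 * k + 1"] \<open>p = 2 * m\<close> by (simp add: block_def)
  have "block r (k + j * m) = block r k" for k j
  proof (induction j)
    case (Suc j)
    then show ?case
      using block_period[of "k + j * m"] by (simp add: ac_simps)
  qed simp
  from this[of "k mod m" "k div m" for k] have block_mod: "block r (k mod m) = block r k" for k
    by simp
  have "card {k. k < m \<and> block r k = (2, 1)} = 1"
    using assms(3) by (simp add: block_count_def p_def m_def)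
  then obtain a where a: "{k. k < m \<and> block r k = (2, 1)} = {a}"
    by (auto simp: card_1_singleton_iff)
  then have "a < m" and block_a: "block r a = (2, 1)"
    by auto
  \<comment> \<open>The first block is 12 because \<open>r\<close> starts with 1.\<close>
  have "a > 0"
    using block_a r(3) by (cases "a = 0") (auto simp: block_def)
  have "block r k = (1, 2) \<longleftrightarrow> block r k \<noteq> (2, 1)" for k
    using blocks[of k] by auto
  then have "{k. k < m \<and> block r k = (1, 2)} = {..<m} - {k. k < m \<and> block r k = (2, 1)}"
    by auto
  also have "\<dots> = {..<m} - {a}"
    by (simp only: a)
  finally have "{k. k < m \<and> block r k = (1, 2)} = {..<m} - {a}" .
  \<comment> \<open>All blocks but one are 12, so having more than one of them means
    \<open>m > 2\<close>.\<close>
  then have "m - 1 > 1"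
    using assms(2) \<open>a < m\<close> by (simp add: block_count_def p_def[symmetric] m_def[symmetric])
  have "block r k = (2, 1) \<longleftrightarrow> k = a" if "k < m" for k
    using a that by blast
  from this[OF mod_less_divisor[OF m]] have flipped: "block r k = (2, 1) \<longleftrightarrow> k mod m = a" for k
    by (simp only: block_mod)
  have w: "(\<lambda>n. r n = 2) = ab (\<lambda>i. i mod m = a)"
  proof
    fix n
    show "(r n = 2) = ab (\<lambda>i. i mod m = a) n"
      using blocks[of "n div 2"] flipped[of "n div 2"]
      by (cases "even n") (auto simp: ab_def block_def elim!: evenE oddE)
  qed
  have "simulates (\<lambda>n. r n = 2) (ab (\<lambda>i. i mod m = a))"
    using simulates_self[of "\<lambda>n. r n = 2"] by (simp add: w)
  then have "simulates (\<lambda>n. r n = 2) (ab (\<lambda>_. False))"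
    using \<open>m - 1 > 1\<close> \<open>a > 0\<close> \<open>a < m\<close>
    by (cases "even m")
      (auto intro: simulates_alternating_odd[of _ m a] simulates_alternating_even[of _ m a])
  then have "models r r'" if "periodic r'" for r'
    using r that by (intro models_if_produces produces_periodic)
  then show ?thesis
    using r(1) by (simp add: universal_def rotor_type_def)
qed

end
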